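(* For a metrizable topological space $X$, the following are equivalent: (a) $X$ is LCS-complete; (b) $X$ is domain-complete; (c) $X$ is completely metrizable.
   Context: A space is domain-complete (resp. LCS-complete) if it is homeomorphic to a $G_\delta$ subset (countable intersection of open sets), with the subspace topology, of some continuous dcpo with its Scott topology (resp. of some locally compact sober space, locally compact meaning every point has a neighborhood base of compact saturated sets). *)

theory Defs
  imports "HOL-Analysis.Analysis"
begin

definition po_on :: "'b set \<Rightarrow> ('b \<Rightarrow> 'b \<Rightarrow> bool) \<Rightarrow> bool" where
  "po_on P le \<equiv> (\<forall>x\<in>P. le x x) \<and>
     (\<forall>x\<in>P. \<forall>y\<in>P. le x y \<and> le y x \<longrightarrow> x = y) \<and>
     (\<forall>x\<in>P. \<forall>y\<in>P. \<forall>z\<in>P. le x y \<and> le y z \<longrightarrow> le x z)"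

definition directed_in :: "'b set \<Rightarrow> ('b \<Rightarrow> 'b \<Rightarrow> bool) \<Rightarrow> 'b set \<Rightarrow> bool" where
  "directed_in P le D \<equiv> D \<subseteq> P \<and> D \<noteq> {} \<and>
     (\<forall>x\<in>D. \<forall>y\<in>D. \<exists>z\<in>D. le x z \<and> le y z)"

definition is_lub_in :: "'b set \<Rightarrow> ('b \<Rightarrow> 'b \<Rightarrow> bool) \<Rightarrow> 'b set \<Rightarrow> 'b \<Rightarrow> bool" where
  "is_lub_in P le D s \<equiv> s \<in> P \<and> (\<forall>d\<in>D. le d s) \<and>
     (\<forall>u\<in>P. (\<forall>d\<in>D. le d u) \<longrightarrow> le s u)"

definition dcpo_on :: "'b set \<Rightarrow> ('b \<Rightarrow> 'b \<Rightarrow> bool) \<Rightarrow> bool" where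
  "dcpo_on P le \<equiv> po_on P le \<and> (\<forall>D. directed_in P le D \<longrightarrow> (\<exists>s. is_lub_in P le D s))"

definition way_below :: "'b set \<Rightarrow> ('b \<Rightarrow> 'b \<Rightarrow> bool) \<Rightarrow> 'b \<Rightarrow> 'b \<Rightarrow> bool" where
  "way_below P le x y \<equiv> \<forall>D s. directed_in P le D \<and> is_lub_in P le D s \<and> le y s
      \<longrightarrow> (\<exists>d\<in>D. le x d)"

definition continuous_dcpo :: "'b set \<Rightarrow> ('b \<Rightarrow> 'b \<Rightarrow> bool) \<Rightarrow> bool" where
  "continuous_dcpo P le \<equiv> dcpo_on P le \<and>
     (\<forall>x\<in>P. directed_in P le {y\<in>P. way_below P le y x} \<and>
             is_lub_in P le {y\<in>P. way_below P le y x} x)"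

definition scott_open :: "'b set \<Rightarrow> ('b \<Rightarrow> 'b \<Rightarrow> bool) \<Rightarrow> 'b set \<Rightarrow> bool" where
  "scott_open P le U \<equiv> U \<subseteq> P \<and> (\<forall>x\<in>U. \<forall>y\<in>P. le x y \<longrightarrow> y \<in> U) \<and>
     (\<forall>D s. directed_in P le D \<and> is_lub_in P le D s \<and> s \<in> U \<longrightarrow> D \<inter> U \<noteq> {})"

lemma istopology_scott_open: "istopology (scott_open P le)"
  unfolding istopology_def
proof (intro conjI allI impI ballI)
  fix S T assume S: "scott_open P le S" and T: "scott_open P le T"
  show "scott_open P le (S \<inter> T)"
    unfolding scott_open_def
  proof (intro conjI allI impI ballI)
    show "S \<inter> T \<subseteq> P" using S unfolding scott_open_def by blast
    fix x y assume "x \<in> S \<inter> T" "y \<in> P" "le x y"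
    then show "y \<in> S \<inter> T" using S T unfolding scott_open_def by blast
  next
    fix D s assume H: "directed_in P le D \<and> is_lub_in P le D s \<and> s \<in> S \<inter> T"
    then obtain a b where a: "a \<in> D \<inter> S" and b: "b \<in> D \<inter> T"
      using S T unfolding scott_open_def by blast
    then obtain z where z: "z \<in> D" "le a z" "le b z"
      using H unfolding directed_in_def by blast
    have "z \<in> P" using z H unfolding directed_in_def by blast
    then have "z \<in> S" "z \<in> T" using S T a b z unfolding scott_open_def by blast+
    then show "D \<inter> (S \<inter> T) \<noteq> {}" using z by blast
  qed
next
  fix K assume K: "\<forall>S\<in>K. scott_open P le S"
  show "scott_open P le (\<Union>K)"
    unfolding scott_open_def
  proof (intro conjI allI impI ballI)
    show "\<Union>K \<subseteq> P" using K unfolding scott_open_def by blast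
    fix x y assume "x \<in> \<Union>K" "y \<in> P" "le x y"
    then show "y \<in> \<Union>K" using K unfolding scott_open_def by blast
  next
    fix D s assume H: "directed_in P le D \<and> is_lub_in P le D s \<and> s \<in> \<Union>K"
    then obtain S where "S \<in> K" "s \<in> S" by blast
    then show "D \<inter> \<Union>K \<noteq> {}" using K H unfolding scott_open_def by blast
  qed
qed

definition scott_topology :: "'b set \<Rightarrow> ('b \<Rightarrow> 'b \<Rightarrow> bool) \<Rightarrow> 'b topology" where
  "scott_topology P le = topology (scott_open P le)"

lemma openin_scott_topology: "openin (scott_topology P le) U \<longleftrightarrow> scott_open P le U"
  unfolding scott_topology_def topology_inverse'[OF istopology_scott_open] by (rule refl)

definition irreducible_closed_in :: "'b topology \<Rightarrow> 'b set \<Rightarrow> bool" where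
  "irreducible_closed_in Y C \<equiv> closedin Y C \<and> C \<noteq> {} \<and>
     (\<forall>A B. closedin Y A \<and> closedin Y B \<and> C \<subseteq> A \<union> B \<longrightarrow> C \<subseteq> A \<or> C \<subseteq> B)"

definition sober_space :: "'b topology \<Rightarrow> bool" where
  "sober_space Y \<equiv> \<forall>C. irreducible_closed_in Y C \<longrightarrow>
     (\<exists>!x. x \<in> topspace Y \<and> C = Y closure_of {x})"

definition saturated_in :: "'b topology \<Rightarrow> 'b set \<Rightarrow> bool" where
  "saturated_in Y K \<equiv> K \<subseteq> topspace Y \<and>
     (\<forall>x\<in>topspace Y. (\<forall>U. openin Y U \<and> K \<subseteq> U \<longrightarrow> x \<in> U) \<longrightarrow> x \<in> K)"

definition locally_compact_sat :: "'b topology \<Rightarrow> bool" where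
  "locally_compact_sat Y \<equiv> \<forall>x\<in>topspace Y. \<forall>U. openin Y U \<and> x \<in> U \<longrightarrow>
     (\<exists>K. compactin Y K \<and> saturated_in Y K \<and> x \<in> Y interior_of K \<and> K \<subseteq> U)"

text \<open>Since HOL cannot quantify over types inside a formula, the ambient space of the
  witness is taken from a type given as a parameter.\<close>

definition domain_complete_in :: "'b itself \<Rightarrow> 'a topology \<Rightarrow> bool" where
  "domain_complete_in (T :: 'b itself) X \<equiv>
     \<exists>(P :: 'b set) le S. continuous_dcpo P le \<and> gdelta_in (scott_topology P le) S \<and>
        X homeomorphic_space subtopology (scott_topology P le) S"

definition LCS_complete_in :: "'b itself \<Rightarrow> 'a topology \<Rightarrow> bool" where
  "LCS_complete_in (T :: 'b itself) X \<equiv>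
     \<exists>(Y :: 'b topology) S. sober_space Y \<and> locally_compact_sat Y \<and> gdelta_in Y S \<and>
        X homeomorphic_space subtopology Y S"

end

theory Submission
  imports Defs
begin

text \<open>
  If \<open>X\<close> is complete, the formal balls \<open>(x, r)\<close> with \<open>r \<ge> 0\<close>, ordered by
  \<open>(x, r) \<le> (y, s)\<close> iff \<open>d x y \<le> r - s\<close> (Edalat--Heckmann), form a continuous dcpo in which
  \<open>X\<close> sits as the \<open>G\<^sub>\<delta>\<close> set of balls of radius \<open>0\<close>. Continuous dcpos are sober and locally
  compact, so domain-completeness implies LCS-completeness.

  If \<open>X\<close> is a \<open>G\<^sub>\<delta>\<close> subset \<open>\<Inter>n. U n\<close> of a locally compact sober space, attach to each point \<open>x\<close> a
  decreasing sequence of compact saturated neighbourhoods \<open>\<beta> x (n + 1) \<subseteq> U n\<close>, each the least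
  possible one with respect to a fixed well-ordering. Let \<open>W n\<close> be the union of balls around the
  points of \<open>X\<close>, in the metric completion, so small that the first \<open>n\<close> neighbourhoods of the
  centre contain the points of \<open>X\<close> in the ball. If \<open>p\<close> lies in every \<open>W n\<close>, the centres \<open>x n\<close> of the
  witnessing balls converge to \<open>p\<close>, and minimality forces \<open>\<beta> (x n) k\<close> to be eventually constant in
  \<open>n\<close> for every \<open>k\<close>. By sobriety the sequence \<open>x n\<close> then clusters at a point of the intersection of
  these constant values, hence of \<open>X\<close>, and that point is \<open>p\<close>. So \<open>X = \<Inter>n. W n\<close> is a \<open>G\<^sub>\<delta>\<close> set in its
  completion.
\<close>

subsection \<open>The Scott topology of a continuous dcpo\<close>

lemma scott_openD:
  assumes "scott_open P le U"
  shows scott_open_upward: "\<lbrakk>x \<in> U; y \<in> P; le x y\<rbrakk> \<Longrightarrow> y \<in> U"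
    and scott_open_meets: "\<lbrakk>directed_in P le D; is_lub_in P le D s; s \<in> U\<rbrakk> \<Longrightarrow> D \<inter> U \<noteq> {}"
  using assms unfolding scott_open_def by blast+

lemma po_onD:
  assumes "po_on P le"
  shows po_on_refl: "x \<in> P \<Longrightarrow> le x x"
    and po_on_antisym: "\<lbrakk>x \<in> P; y \<in> P; le x y; le y x\<rbrakk> \<Longrightarrow> x = y"
    and po_on_trans: "\<lbrakk>x \<in> P; y \<in> P; z \<in> P; le x y; le y z\<rbrakk> \<Longrightarrow> le x z"
  using assms unfolding po_on_def by blast+

lemma continuous_dcpoD:
  assumes "continuous_dcpo P le"
  shows continuous_dcpo_po: "po_on P le"
    and continuous_dcpo_lub: "directed_in P le D \<Longrightarrow> \<exists>s. is_lub_in P le D s"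
    and continuous_dcpo_directed: "x \<in> P \<Longrightarrow> directed_in P le {y\<in>P. way_below P le y x}"
    and continuous_dcpo_approx: "x \<in> P \<Longrightarrow> is_lub_in P le {y\<in>P. way_below P le y x} x"
  using assms unfolding continuous_dcpo_def dcpo_on_def by blast+

section \<open>The way-below relation and its interpolation property\<close>

lemma way_below_le:
  assumes "po_on P le" "way_below P le x y" "y \<in> P"
  shows "le x y"
proof -
  have "directed_in P le {y}" "is_lub_in P le {y} y" "le y y"
    using po_on_refl[OF assms(1,3)] assms(3) by (simp_all add: directed_in_def is_lub_in_def)
  then show ?thesis
    using assms(2) unfolding way_below_def by blast
qed

lemma way_below_le_trans:
  assumes "po_on P le" "way_below P le x y" "le y z" "y \<in> P" "z \<in> P"
  shows "way_below P le x z"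
  unfolding way_below_def
proof (intro allI impI, elim conjE)
  fix D s assume D: "directed_in P le D" "is_lub_in P le D s" "le z s"
  then have "le y s"
    using assms po_on_trans[OF assms(1), of y z s] by (auto simp: is_lub_in_def)
  then show "\<exists>d\<in>D. le x d"
    using assms(2) D unfolding way_below_def by blast
qed

lemma le_way_below_trans:
  assumes "po_on P le" "le x y" "way_below P le y z" "x \<in> P" "y \<in> P"
  shows "way_below P le x z"
  unfolding way_below_def
proof (intro allI impI, elim conjE)
  fix D s assume D: "directed_in P le D" "is_lub_in P le D s" "le z s"
  then obtain d where "d \<in> D" "le y d"
    using assms(3) unfolding way_below_def by blast
  then show "\<exists>d\<in>D. le x d"
    using assms D po_on_trans[OF assms(1), of x y d] by (auto simp: directed_in_def)
qed

lemma way_below_directed_pair: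
  assumes "continuous_dcpo P le" "x \<in> P" "a \<in> P" "b \<in> P" "way_below P le a x" "way_below P le b x"
  obtains c where "c \<in> P" "way_below P le c x" "le a c" "le b c"
  using continuous_dcpo_directed[OF assms(1,2)] assms(3-) unfolding directed_in_def by blast

text \<open>The elements way below something way below \<open>y\<close> form a directed set whose
  supremum lies above \<open>y\<close>. Since \<open>x\<close> is way below \<open>y\<close>, some
  member of this set is above \<open>x\<close>, and the intermediate element of that member
  interpolates.\<close>

lemma way_below_interpolate:
  assumes c: "continuous_dcpo P le" and xy: "way_below P le x y" "x \<in> P" "y \<in> P"
  obtains z where "z \<in> P" "way_below P le x z" "way_below P le z y"
proof -
  note po = continuous_dcpo_po[OF c]
  define D where "D = {w\<in>P. \<exists>z\<in>P. way_below P le w z \<and> way_below P le z y}"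
  have "directed_in P le D"
    unfolding directed_in_def
  proof (intro conjI ballI)
    show "D \<subseteq> P" by (auto simp: D_def)
    obtain z where z: "z \<in> P" "way_below P le z y"
      using continuous_dcpo_directed[OF c \<open>y \<in> P\<close>] unfolding directed_in_def by blast
    obtain w where "w \<in> P" "way_below P le w z"
      using continuous_dcpo_directed[OF c \<open>z \<in> P\<close>] unfolding directed_in_def by blast
    with z show "D \<noteq> {}" by (auto simp: D_def)
    fix a b assume "a \<in> D" "b \<in> D"
    then obtain a' b' where a: "a \<in> P" "a' \<in> P" "way_below P le a a'" "way_below P le a' y"
      and b: "b \<in> P" "b' \<in> P" "way_below P le b b'" "way_below P le b' y"
      by (auto simp: D_def)
    obtain z where z: "z \<in> P" "way_below P le z y" "le a' z" "le b' z"
      using way_below_directed_pair[OF c \<open>y \<in> P\<close> a(2) b(2) a(4) b(4)] .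
    have az: "way_below P le a z" "way_below P le b z"
      using way_below_le_trans[OF po a(3) z(3)] way_below_le_trans[OF po b(3) z(4)] a b z by auto
    obtain w where "w \<in> P" "way_below P le w z" "le a w" "le b w"
      using way_below_directed_pair[OF c \<open>z \<in> P\<close> a(1) b(1) az] .
    then show "\<exists>w\<in>D. le a w \<and> le b w"
      using z by (auto simp: D_def)
  qed
  moreover from this obtain s where s: "is_lub_in P le D s"
    using continuous_dcpo_lub[OF c] by blast
  \<comment> \<open>Approximation is used twice: \<open>s\<close> bounds everything way below each
    such \<open>z\<close>, hence \<open>z\<close> itself, and therefore \<open>y\<close>.\<close>
  moreover have "le y s"
  proof -
    have "le z s" if "z \<in> P" "way_below P le z y" for z
    proof -
      have "\<forall>w \<in> {w\<in>P. way_below P le w z}. le w s"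
        using that s by (auto simp: is_lub_in_def D_def)
      then show ?thesis
        using continuous_dcpo_approx[OF c that(1)] s by (auto simp: is_lub_in_def)
    qed
    then show ?thesis
      using continuous_dcpo_approx[OF c \<open>y \<in> P\<close>] s by (auto simp: is_lub_in_def)
  qed
  ultimately obtain d where "d \<in> D" "le x d"
    using xy(1) unfolding way_below_def by blast
  then obtain z where "d \<in> P" "z \<in> P" "way_below P le d z" "way_below P le z y"
    by (auto simp: D_def)
  moreover from this have "way_below P le x z"
    using le_way_below_trans[OF po \<open>le x d\<close>, of z] xy by simp
  ultimately show thesis
    by (intro that)
qed

text \<open>Interpolation makes the set inaccessible by directed suprema: with \<open>z\<close>
  between \<open>x\<close> and the supremum, a member of \<open>D\<close> above \<open>z\<close> is
  already way above \<open>x\<close>.\<close>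

lemma scott_open_way_above:
  assumes c: "continuous_dcpo P le" and "x \<in> P"
  shows "scott_open P le {y\<in>P. way_below P le x y}"
  unfolding scott_open_def
proof (intro conjI allI impI ballI)
  note po = continuous_dcpo_po[OF c]
  fix y z assume "y \<in> {y\<in>P. way_below P le x y}" "z \<in> P" "le y z"
  then show "z \<in> {y\<in>P. way_below P le x y}"
    using way_below_le_trans[OF po, of x y z] by simp
next
  note po = continuous_dcpo_po[OF c]
  fix D s
  assume "directed_in P le D \<and> is_lub_in P le D s \<and> s \<in> {y\<in>P. way_below P le x y}"
  then have D: "directed_in P le D" "is_lub_in P le D s" and s: "s \<in> P" "way_below P le x s"
    by auto
  obtain z where z: "z \<in> P" "way_below P le x z" "way_below P le z s"
    using way_below_interpolate[OF c s(2) \<open>x \<in> P\<close> s(1)] .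
  obtain d where d: "d \<in> D" "le z d"
    using z(3) D po_on_refl[OF po s(1)] unfolding way_below_def by blast
  then have "d \<in> P"
    using D by (auto simp: directed_in_def)
  then have "way_below P le x d"
    using way_below_le_trans[OF po z(2) d(2) z(1)] by simp
  then show "D \<inter> {y\<in>P. way_below P le x y} \<noteq> {}"
    using d \<open>d \<in> P\<close> by auto
qed auto

section \<open>Scott-closed sets, sobriety and local compactness\<close>

lemma topspace_scott_topology [simp]: "topspace (scott_topology P le) = P"
proof -
  have "scott_open P le P"
    unfolding scott_open_def directed_in_def by blast
  moreover have "scott_open P le U \<Longrightarrow> U \<subseteq> P" for U
    unfolding scott_open_def by blast
  ultimately show ?thesis
    unfolding topspace_def openin_scott_topology by blast
qed

lemma closedin_scott_topology_downward:
  assumes "closedin (scott_topology P le) C" "y \<in> C" "x \<in> P" "le x y"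
  shows "x \<in> C"
proof -
  have "scott_open P le (P - C)" "C \<subseteq> P"
    using assms(1) by (auto simp: closedin_def openin_scott_topology)
  then show ?thesis
    using assms(2-) unfolding scott_open_def by blast
qed

lemma closedin_scott_topology_lub:
  assumes "closedin (scott_topology P le) C" "directed_in P le D" "is_lub_in P le D s" "D \<subseteq> C"
  shows "s \<in> C"
proof (rule ccontr)
  assume "s \<notin> C"
  moreover have "scott_open P le (P - C)"
    using assms(1) by (auto simp: closedin_def openin_scott_topology)
  moreover have "s \<in> P"
    using assms(3) by (auto simp: is_lub_in_def)
  ultimately show False
    using assms unfolding scott_open_def by blast
qed

lemma closure_of_singleton_scott:
  assumes po: "po_on P le" and "s \<in> P"
  shows "scott_topology P le closure_of {s} = {x\<in>P. le x s}"
proof (rule closure_of_unique)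
  show "{s} \<subseteq> {x\<in>P. le x s}"
    using assms po_on_refl[OF po] by blast
  have "scott_open P le (P - {x\<in>P. le x s})"
    unfolding scott_open_def
  proof (intro conjI allI impI ballI)
    fix x y assume "x \<in> P - {x\<in>P. le x s}" "y \<in> P" "le x y"
    then show "y \<in> P - {x\<in>P. le x s}"
      using po_on_trans[OF po, of x y s] \<open>s \<in> P\<close> by blast
  next
    fix D t
    assume "directed_in P le D \<and> is_lub_in P le D t \<and> t \<in> P - {x\<in>P. le x s}"
    then have "D \<subseteq> P" "\<not> (\<forall>d\<in>D. le d s)"
      using \<open>s \<in> P\<close> by (auto simp: is_lub_in_def directed_in_def)
    then show "D \<inter> (P - {x\<in>P. le x s}) \<noteq> {}"
      by blast
  qed auto
  then show "closedin (scott_topology P le) {x\<in>P. le x s}"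
    by (auto simp: closedin_def openin_scott_topology)
  show "{x\<in>P. le x s} \<subseteq> T" if "{s} \<subseteq> T" "closedin (scott_topology P le) T" for T
    using that closedin_scott_topology_downward[OF that(2), of s] by auto
qed

text \<open>The generic point of an irreducible closed set \<open>C\<close> is the supremum of all
  elements way below some point of \<open>C\<close>. Irreducibility makes these elements directed,
  and closedness puts the supremum in \<open>C\<close>.\<close>

lemma sober_space_scott:
  assumes c: "continuous_dcpo P le"
  shows "sober_space (scott_topology P le)"
  unfolding sober_space_def
proof (intro allI impI)
  note po = continuous_dcpo_po[OF c]
  fix C assume C: "irreducible_closed_in (scott_topology P le) C"
  then have clC: "closedin (scott_topology P le) C" and "C \<noteq> {}"
    by (auto simp: irreducible_closed_in_def)
  then have "C \<subseteq> P"
    using closedin_subset by fastforce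
  \<comment> \<open>Irreducibility in terms of open sets; applied below to the sets of points way
    above \<open>a\<close> and way above \<open>b\<close>.\<close>
  have meet: "\<exists>c\<in>C. c \<in> U \<inter> V"
    if "scott_open P le U" "scott_open P le V" "C \<inter> U \<noteq> {}" "C \<inter> V \<noteq> {}" for U V
  proof (rule ccontr)
    assume "\<not> ?thesis"
    then have "C \<subseteq> (P - U) \<union> (P - V)"
      using \<open>C \<subseteq> P\<close> by blast
    moreover have "closedin (scott_topology P le) (P - U)" "closedin (scott_topology P le) (P - V)"
      using that by (metis openin_scott_topology openin_closedin_eq topspace_scott_topology)+
    ultimately have "C \<subseteq> P - U \<or> C \<subseteq> P - V"
      using C unfolding irreducible_closed_in_def by blast
    then show False
      using that by blast
  qed
  define D where "D = {y\<in>P. \<exists>c\<in>C. way_below P le y c}"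
  have D: "directed_in P le D"
    unfolding directed_in_def
  proof (intro conjI ballI)
    show "D \<subseteq> P" by (auto simp: D_def)
    obtain c where "c \<in> C" using \<open>C \<noteq> {}\<close> by blast
    then have "c \<in> P" using \<open>C \<subseteq> P\<close> by blast
    obtain y where "y \<in> P" "way_below P le y c"
      using continuous_dcpo_directed[OF c \<open>c \<in> P\<close>] unfolding directed_in_def by blast
    then show "D \<noteq> {}" using \<open>c \<in> C\<close> by (auto simp: D_def)
    fix a b assume ab: "a \<in> D" "b \<in> D"
    then have "a \<in> P" "b \<in> P" by (auto simp: D_def)
    then have "\<exists>e\<in>C. e \<in> {y\<in>P. way_below P le a y} \<inter> {y\<in>P. way_below P le b y}"
      using ab \<open>C \<subseteq> P\<close> by (intro meet scott_open_way_above c) (auto simp: D_def)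
    then obtain e where e: "e \<in> C" "e \<in> P" "way_below P le a e" "way_below P le b e"
      by blast
    obtain z where "z \<in> P" "way_below P le z e" "le a z" "le b z"
      using way_below_directed_pair[OF c e(2) \<open>a \<in> P\<close> \<open>b \<in> P\<close> e(3,4)] .
    then show "\<exists>z\<in>D. le a z \<and> le b z"
      using e(1) by (auto simp: D_def)
  qed
  then obtain s where s: "is_lub_in P le D s"
    using continuous_dcpo_lub[OF c] by blast
  then have "s \<in> P" by (auto simp: is_lub_in_def)
  have "D \<subseteq> C"
  proof
    fix y assume "y \<in> D"
    then obtain e where "y \<in> P" "e \<in> C" "way_below P le y e"
      by (auto simp: D_def)
    then show "y \<in> C"
      using closedin_scott_topology_downward[OF clC] way_below_le[OF po] \<open>C \<subseteq> P\<close> by blast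
  qed
  then have "s \<in> C"
    using closedin_scott_topology_lub[OF clC D s] by blast
  have "le e s" if "e \<in> C" for e
  proof -
    have "\<forall>y\<in>{y\<in>P. way_below P le y e}. le y s"
      using s that by (auto simp: is_lub_in_def D_def)
    then show ?thesis
      using continuous_dcpo_approx[OF c, of e] that \<open>C \<subseteq> P\<close> \<open>s \<in> P\<close> by (auto simp: is_lub_in_def)
  qed
  then have "C = {x\<in>P. le x s}"
    using \<open>C \<subseteq> P\<close> closedin_scott_topology_downward[OF clC \<open>s \<in> C\<close>] by auto
  then have "C = scott_topology P le closure_of {s}"
    by (simp add: closure_of_singleton_scott[OF po \<open>s \<in> P\<close>])
  then show "\<exists>!x. x \<in> topspace (scott_topology P le) \<and> C = scott_topology P le closure_of {x}"
  proof (intro ex1I conjI)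
    fix x assume x: "x \<in> topspace (scott_topology P le) \<and> C = scott_topology P le closure_of {x}"
    then have "x \<in> P" "{y\<in>P. le y x} = {y\<in>P. le y s}"
      using closure_of_singleton_scott[OF po] \<open>C = {x\<in>P. le x s}\<close> by auto
    then have "le x s" "le s x"
      using po_on_refl[OF po] \<open>s \<in> P\<close> by blast+
    then show "x = s"
      by (rule po_on_antisym[OF po \<open>x \<in> P\<close> \<open>s \<in> P\<close>])
  qed (use \<open>s \<in> P\<close> in auto)
qed

text \<open>Principal upper sets serve as compact neighbourhoods: an open set containing the least
  element contains the whole set, so one member of a cover suffices.\<close>

lemma locally_compact_sat_scott:
  assumes c: "continuous_dcpo P le"
  shows "locally_compact_sat (scott_topology P le)"
  unfolding locally_compact_sat_def
proof (intro ballI allI impI, elim conjE)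
  note po = continuous_dcpo_po[OF c]
  fix x U assume "x \<in> topspace (scott_topology P le)"
    and U: "openin (scott_topology P le) U" "x \<in> U"
  then have "x \<in> P" by simp
  have upw: "z \<in> V" if "openin (scott_topology P le) V" "y \<in> V" "z \<in> P" "le y z" for V y z
    using that unfolding openin_scott_topology scott_open_def by blast
  \<comment> \<open>\<open>x\<close> is the directed supremum of this set, so the Scott-open set
    \<open>U\<close> meets it.\<close>
  have "{y\<in>P. way_below P le y x} \<inter> U \<noteq> {}"
    using U continuous_dcpo_directed[OF c \<open>x \<in> P\<close>] continuous_dcpo_approx[OF c \<open>x \<in> P\<close>]
    by (intro scott_open_meets) (simp_all add: openin_scott_topology)
  then obtain y where y: "y \<in> P" "way_below P le y x" "y \<in> U"
    by blast
  define K where "K = {z\<in>P. le y z}"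
  have "y \<in> K"
    using y po_on_refl[OF po] by (auto simp: K_def)
  have "compactin (scott_topology P le) K"
    unfolding compactin_def
  proof (intro conjI allI impI)
    fix \<U> assume *: "(\<forall>V\<in>\<U>. openin (scott_topology P le) V) \<and> K \<subseteq> \<Union>\<U>"
    then obtain V where "V \<in> \<U>" "y \<in> V"
      using \<open>y \<in> K\<close> by blast
    then have "K \<subseteq> V"
      using upw * by (auto simp: K_def)
    then show "\<exists>\<F>. finite \<F> \<and> \<F> \<subseteq> \<U> \<and> K \<subseteq> \<Union>\<F>"
      using \<open>V \<in> \<U>\<close> by (intro exI[of _ "{V}"]) auto
  qed (auto simp: K_def)
  moreover have "saturated_in (scott_topology P le) K"
    unfolding saturated_in_def
  proof (intro conjI ballI impI)
    fix z assume z: "z \<in> topspace (scott_topology P le)"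
      "\<forall>V. openin (scott_topology P le) V \<and> K \<subseteq> V \<longrightarrow> z \<in> V"
    \<comment> \<open>The complement of the lower set of \<open>z\<close> is open and misses
      \<open>z\<close>, so it cannot contain \<open>K\<close>; hence some element of
      \<open>K\<close> is below \<open>z\<close>.\<close>
    have "closedin (scott_topology P le) {w\<in>P. le w z}"
      using closure_of_singleton_scott[OF po, of z] z(1) closedin_closure_of by (metis topspace_scott_topology)
    then have "openin (scott_topology P le) (P - {w\<in>P. le w z})"
      by (metis openin_closedin_eq closedin_def topspace_scott_topology)
    moreover have "z \<notin> P - {w\<in>P. le w z}"
      using z(1) po_on_refl[OF po] by auto
    ultimately obtain w where "w \<in> K" "w \<in> P" "le w z"
      using z(2) by (auto simp: K_def)
    then show "z \<in> K"
      using z(1) y(1) po_on_trans[OF po, of y w z] by (auto simp: K_def)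
  qed (auto simp: K_def)
  moreover have "x \<in> scott_topology P le interior_of K"
    unfolding interior_of_def
    using scott_open_way_above[OF c y(1)] \<open>x \<in> P\<close> y(2) way_below_le[OF po]
    by (auto simp: openin_scott_topology K_def intro!: exI[of _ "{z\<in>P. way_below P le y z}"])
  moreover have "K \<subseteq> U"
    using upw[OF U(1) y(3)] by (auto simp: K_def)
  ultimately show "\<exists>K. compactin (scott_topology P le) K \<and> saturated_in (scott_topology P le) K \<and>
      x \<in> scott_topology P le interior_of K \<and> K \<subseteq> U"
    by blast
qed

lemma domain_complete_imp_LCS_complete:
  "domain_complete_in TYPE('b) X \<Longrightarrow> LCS_complete_in TYPE('b) X"
  unfolding domain_complete_in_def LCS_complete_in_def
  using sober_space_scott locally_compact_sat_scott by blast

subsection \<open>Formal balls\<close>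

text \<open>A pair is a centre with a radius. Going up in the order shrinks the ball: by the
  triangle inequality the upper ball is contained in the lower one.\<close>

definition ball_le :: "('a \<Rightarrow> 'a \<Rightarrow> real) \<Rightarrow> 'a \<times> real \<Rightarrow> 'a \<times> real \<Rightarrow> bool" where
  "ball_le d p q \<longleftrightarrow> d (fst p) (fst q) \<le> snd p - snd q"

lemma is_lub_in_unique:
  assumes "po_on P le" "is_lub_in P le D s" "is_lub_in P le D t"
  shows "s = t"
  using assms(2,3) po_on_antisym[OF assms(1), of s t] by (simp add: is_lub_in_def)

context Metric_space
begin

abbreviation formal_balls :: "('a \<times> real) set" where
  "formal_balls \<equiv> M \<times> {0..}"

lemma po_on_formal_balls: "po_on formal_balls (ball_le d)"
  unfolding po_on_def
proof (intro conjI ballI impI)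
  show "ball_le d p p" if "p \<in> formal_balls" for p
    using that by (auto simp: ball_le_def)
  show "p = q" if "p \<in> formal_balls" "q \<in> formal_balls" "ball_le d p q \<and> ball_le d q p" for p q
  proof -
    have "d (fst p) (fst q) \<le> 0"
      using that(3) commute[of "fst p" "fst q"] by (simp add: ball_le_def)
    then have "d (fst p) (fst q) = 0"
      using nonneg[of "fst p" "fst q"] by simp
    then show ?thesis
      using that by (auto simp: ball_le_def prod_eq_iff)
  qed
  show "ball_le d p s" if "p \<in> formal_balls" "q \<in> formal_balls" "s \<in> formal_balls"
    "ball_le d p q \<and> ball_le d q s" for p q s
    using that triangle[of "fst p" "fst q" "fst s"] by (auto simp: ball_le_def)
qed

text \<open>The supremum has the infimum \<open>r\<close> of the radii as radius, and as centre the
  limit of centres whose radii tend to \<open>r\<close>. The second conclusion keeps the information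
  on the radius.\<close>

lemma formal_balls_lub:
  assumes "mcomplete" and D: "directed_in formal_balls (ball_le d) D"
  obtains s where "is_lub_in formal_balls (ball_le d) D s"
    "\<And>e. e > 0 \<Longrightarrow> \<exists>p\<in>D. snd p < snd s + e"
proof -
  define r where "r = Inf (snd ` D)"
  have DP: "fst p \<in> M" "0 \<le> snd p" if "p \<in> D" for p
    using that D by (auto simp: directed_in_def)
  have "D \<noteq> {}"
    using D by (simp add: directed_in_def)
  have bdd: "bdd_below (snd ` D)"
    using DP by (intro bdd_belowI[of _ 0]) auto
  have r_le: "r \<le> snd p" if "p \<in> D" for p
    unfolding r_def using bdd that by (intro cInf_lower) auto
  have "r \<ge> 0"
    unfolding r_def using DP \<open>D \<noteq> {}\<close> by (intro cInf_greatest) auto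
  have approx: "\<exists>p\<in>D. snd p < r + e" if "e > 0" for e
    using cInf_lessD[of "snd ` D" "r + e"] that \<open>D \<noteq> {}\<close> by (auto simp: r_def)
  \<comment> \<open>Compare both centres with that of a common upper bound in \<open>D\<close>,
    whose radius is at least \<open>r\<close>. This yields the Cauchy property.\<close>
  have dist: "d (fst p) (fst q) \<le> (snd p - r) + (snd q - r)" if "p \<in> D" "q \<in> D" for p q
  proof -
    have "\<exists>z\<in>D. ball_le d p z \<and> ball_le d q z"
      using D that by (simp add: directed_in_def)
    then obtain z where "z \<in> D" "ball_le d p z" "ball_le d q z"
      by blast
    then show ?thesis
      using r_le[of z] triangle[of "fst p" "fst z" "fst q"] commute[of "fst z" "fst q"] DP that
      by (simp add: ball_le_def)
  qed
  have "\<forall>n. \<exists>p. p \<in> D \<and> snd p < r + inverse (real (Suc n))"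
  proof
    fix n
    have "\<exists>p\<in>D. snd p < r + inverse (real (Suc n))"
      by (rule approx) simp
    then show "\<exists>p. p \<in> D \<and> snd p < r + inverse (real (Suc n))"
      by blast
  qed
  from choice[OF this] obtain p
    where "\<forall>n. p n \<in> D \<and> snd (p n) < r + inverse (real (Suc n))" ..
  then have p: "p n \<in> D" "snd (p n) < r + inverse (real (Suc n))" for n
    by auto
  have small: "\<exists>N. \<forall>n\<ge>N. snd (p n) - r < e" if "e > 0" for e
  proof -
    have "\<forall>\<^sub>F n in sequentially. inverse (real (Suc n)) < e"
      using Archimedean_eventually_inverse that by blast
    then obtain N where "\<And>n. n \<ge> N \<Longrightarrow> inverse (real (Suc n)) < e"
      by (auto simp: eventually_sequentially)
    then show ?thesis
      using p(2) by (intro exI[of _ N]) (smt (verit))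
  qed
  have "MCauchy (\<lambda>n. fst (p n))"
    unfolding MCauchy_def
  proof (intro conjI allI impI)
    show "range (\<lambda>n. fst (p n)) \<subseteq> M"
      using DP(1)[OF p(1)] by blast
    fix e :: real assume "e > 0"
    then obtain N where N: "\<And>n. n \<ge> N \<Longrightarrow> snd (p n) - r < e/2"
      using small[of "e/2"] by auto
    have "d (fst (p n)) (fst (p n')) < e" if "N \<le> n" "N \<le> n'" for n n'
      using N[OF that(1)] N[OF that(2)] dist[OF p(1) p(1), of n n'] by linarith
    then show "\<exists>N. \<forall>n n'. N \<le> n \<longrightarrow> N \<le> n' \<longrightarrow> d (fst (p n)) (fst (p n')) < e"
      by auto
  qed
  then obtain x where x: "limitin mtopology (\<lambda>n. fst (p n)) x sequentially"
    using \<open>mcomplete\<close> by (auto simp: mcomplete_def)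
  then have "x \<in> M"
    by (rule limitin_mspace)
  have close: "\<exists>n. d (fst (p n)) x < e \<and> snd (p n) - r < e" if "e > 0" for e
  proof -
    obtain N1 where "\<forall>n\<ge>N1. d (fst (p n)) x < e"
      using x \<open>e > 0\<close> unfolding limit_metric_sequentially by meson
    moreover obtain N2 where "\<forall>n\<ge>N2. snd (p n) - r < e"
      using small[OF \<open>e > 0\<close>] by blast
    ultimately show ?thesis
      by (intro exI[of _ "max N1 N2"]) simp
  qed
  have "is_lub_in formal_balls (ball_le d) D (x, r)"
    unfolding is_lub_in_def
  proof (intro conjI ballI impI)
    show "(x, r) \<in> formal_balls"
      using \<open>x \<in> M\<close> \<open>r \<ge> 0\<close> by simp
    show "ball_le d q (x, r)" if "q \<in> D" for q
    proof -
      have "d (fst q) x \<le> snd q - r"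
      proof (rule field_le_epsilon)
        fix e :: real assume "e > 0"
        then obtain n where "d (fst (p n)) x < e/2" "snd (p n) - r < e/2"
          using close[of "e/2"] by auto
        then show "d (fst q) x \<le> snd q - r + e"
          using dist[OF that p(1), of n] triangle[of "fst q" "fst (p n)" x] DP that p(1) \<open>x \<in> M\<close>
          by fastforce
      qed
      then show ?thesis by (simp add: ball_le_def)
    qed
    show "ball_le d (x, r) u" if "u \<in> formal_balls" "\<forall>q\<in>D. ball_le d q u" for u
    proof -
      have "d x (fst u) \<le> r - snd u"
      proof (rule field_le_epsilon)
        fix e :: real assume "e > 0"
        then obtain n where n: "d (fst (p n)) x < e/2" "snd (p n) - r < e/2"
          using close[of "e/2"] by auto
        moreover have "d (fst (p n)) (fst u) \<le> snd (p n) - snd u"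
          using that(2) p(1) by (auto simp: ball_le_def)
        moreover have "d x (fst u) \<le> d (fst (p n)) x + d (fst (p n)) (fst u)"
          using triangle[of x "fst (p n)" "fst u"] commute[of x "fst (p n)"] DP p(1) \<open>x \<in> M\<close> that(1)
          by auto
        ultimately show "d x (fst u) \<le> r - snd u + e"
          by linarith
      qed
      then show ?thesis by (simp add: ball_le_def)
    qed
  qed
  then show thesis
    using approx by (intro that[of "(x, r)"]) auto
qed

text \<open>Suprema are unique, so \<open>s\<close> is the one constructed above; the order then
  bounds the distance of the centres by the difference of the radii.\<close>

lemma formal_balls_lub_approx:
  assumes "mcomplete" "directed_in formal_balls (ball_le d) D" "is_lub_in formal_balls (ball_le d) D s" "e > 0"
  obtains p where "p \<in> D" "snd p < snd s + e" "d (fst p) (fst s) < e"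
proof -
  obtain t where t: "is_lub_in formal_balls (ball_le d) D t"
    and "\<And>e. e > 0 \<Longrightarrow> \<exists>p\<in>D. snd p < snd t + e"
    using formal_balls_lub[OF assms(1,2)] by metis
  moreover have "t = s"
    using is_lub_in_unique[OF po_on_formal_balls t assms(3)] .
  ultimately obtain p where p: "p \<in> D" "snd p < snd s + e"
    using \<open>e > 0\<close> by blast
  moreover have "d (fst p) (fst s) \<le> snd p - snd s"
    using assms(3) p(1) by (simp add: is_lub_in_def ball_le_def)
  ultimately show thesis
    by (intro that) auto
qed

text \<open>A canonical directed set with a given supremum, used to test the way-below relation and
  Scott-openness.\<close>

lemma larger_radii_lub:
  assumes "y \<in> M" "0 \<le> s"
  shows "directed_in formal_balls (ball_le d) ((\<lambda>t. (y, t)) ` {s<..})"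
    and "is_lub_in formal_balls (ball_le d) ((\<lambda>t. (y, t)) ` {s<..}) (y, s)"
proof -
  have "\<exists>t>s. t \<le> a \<and> t \<le> b" if "a > s" "b > s" for a b :: real
    using that by (intro exI[of _ "min a b"]) auto
  then show "directed_in formal_balls (ball_le d) ((\<lambda>t. (y, t)) ` {s<..})"
    using assms by (auto simp: directed_in_def ball_le_def)
  have "ball_le d (y, s) u" if "\<forall>t>s. ball_le d (y, t) u" for u
  proof -
    have "d y (fst u) \<le> s - snd u"
    proof (rule field_le_epsilon)
      fix e :: real assume "e > 0"
      then show "d y (fst u) \<le> s - snd u + e"
        using that[rule_format, of "s + e"] by (simp add: ball_le_def)
    qed
    then show ?thesis by (simp add: ball_le_def)
  qed
  then show "is_lub_in formal_balls (ball_le d) ((\<lambda>t. (y, t)) ` {s<..}) (y, s)"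
    using assms by (auto simp: is_lub_in_def ball_le_def)
qed

text \<open>Testing against concentric balls of larger radius forces strictness. Conversely, a
  strict inequality leaves slack that absorbs the approximation of a supremum by members of
  \<open>D\<close>.\<close>

lemma way_below_formal_balls:
  assumes "mcomplete" "p \<in> formal_balls" "q \<in> formal_balls"
  shows "way_below formal_balls (ball_le d) p q \<longleftrightarrow> d (fst p) (fst q) < snd p - snd q"
proof
  assume wb: "way_below formal_balls (ball_le d) p q"
  obtain y s where q: "q = (y, s)" "y \<in> M" "0 \<le> s"
    using assms(3) by auto
  have "ball_le d q (y, s)"
    using q by (simp add: ball_le_def)
  with wb larger_radii_lub[OF q(2,3)] obtain t where "t > s" "ball_le d p (y, t)"
    unfolding way_below_def by blast
  then show "d (fst p) (fst q) < snd p - snd q"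
    by (simp add: ball_le_def q)
next
  assume less: "d (fst p) (fst q) < snd p - snd q"
  show "way_below formal_balls (ball_le d) p q"
    unfolding way_below_def
  proof (intro allI impI, elim conjE)
    fix D u
    assume D: "directed_in formal_balls (ball_le d) D" "is_lub_in formal_balls (ball_le d) D u"
      and "ball_le d q u"
    have "fst u \<in> M"
      using D(2) by (auto simp: is_lub_in_def)
    have pu: "d (fst p) (fst u) < snd p - snd u"
      using less \<open>ball_le d q u\<close> triangle[of "fst p" "fst q" "fst u"] assms(2,3) \<open>fst u \<in> M\<close>
      by (auto simp: ball_le_def)
    \<comment> \<open>Half the slack each for the error in the radius and the error in the
      centre.\<close>
    define e where "e = (snd p - snd u - d (fst p) (fst u)) / 2"
    have "e > 0"
      using pu by (simp add: e_def)
    then obtain z where z: "z \<in> D" "snd z < snd u + e" "d (fst z) (fst u) < e"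
      using formal_balls_lub_approx[OF assms(1) D] by blast
    have "fst z \<in> M"
      using D(1) z(1) by (auto simp: directed_in_def)
    then have "d (fst p) (fst z) \<le> d (fst p) (fst u) + d (fst z) (fst u)"
      using triangle[of "fst p" "fst u" "fst z"] commute[of "fst u" "fst z"] assms(2) \<open>fst u \<in> M\<close>
      by auto
    moreover have "2 * e = snd p - snd u - d (fst p) (fst u)"
      by (simp add: e_def)
    ultimately have "ball_le d p z"
      using z(2,3) by (simp add: ball_le_def)
    then show "\<exists>z\<in>D. ball_le d p z"
      using z(1) by blast
  qed
qed

lemma continuous_dcpo_formal_balls:
  assumes "mcomplete"
  shows "continuous_dcpo formal_balls (ball_le d)"
  unfolding continuous_dcpo_def dcpo_on_def
proof (intro conjI allI impI ballI po_on_formal_balls)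
  show "\<exists>s. is_lub_in formal_balls (ball_le d) D s" if "directed_in formal_balls (ball_le d) D" for D
    using formal_balls_lub[OF assms that] by blast
  fix q assume q: "q \<in> formal_balls"
  define D where "D = {p \<in> formal_balls. way_below formal_balls (ball_le d) p q}"
  have D_eq: "D = {p \<in> formal_balls. d (fst p) (fst q) < snd p - snd q}"
    using way_below_formal_balls[OF assms _ q] by (auto simp: D_def)
  obtain y s where ys: "q = (y, s)" "y \<in> M" "0 \<le> s"
    using q by auto
  have radii: "(y, t) \<in> D" if "t > s" for t
    using that ys by (simp add: D_eq)
  show "directed_in formal_balls (ball_le d) {p \<in> formal_balls. way_below formal_balls (ball_le d) p q}"
    unfolding D_def[symmetric] directed_in_def
  proof (intro conjI ballI)
    show "D \<subseteq> formal_balls"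
      by (auto simp: D_def)
    show "D \<noteq> {}"
      using radii[of "s + 1"] by auto
    fix a b assume ab: "a \<in> D" "b \<in> D"
    \<comment> \<open>The largest radius for which the ball around \<open>y\<close> is above both
      \<open>a\<close> and \<open>b\<close>.\<close>
    define t where "t = min (snd a - d (fst a) y) (snd b - d (fst b) y)"
    have "t > s"
      using ab by (auto simp: D_eq t_def ys)
    moreover have "ball_le d a (y, t)" "ball_le d b (y, t)"
      by (auto simp: ball_le_def t_def)
    ultimately show "\<exists>z\<in>D. ball_le d a z \<and> ball_le d b z"
      using radii by blast
  qed
  have "ball_le d q u" if "u \<in> formal_balls" "\<forall>p\<in>D. ball_le d p u" for u
    using larger_radii_lub(2)[OF ys(2,3)] that radii ys(1) by (auto simp: is_lub_in_def)
  moreover have "ball_le d p q" if "p \<in> D" for p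
    using that by (auto simp: D_eq ball_le_def)
  ultimately show "is_lub_in formal_balls (ball_le d)
      {p \<in> formal_balls. way_below formal_balls (ball_le d) p q} q"
    unfolding D_def[symmetric] is_lub_in_def using q by blast
qed

section \<open>The metric space as the set of formal balls of radius zero\<close>

lemma scott_open_radius_less:
  assumes "mcomplete"
  shows "scott_open formal_balls (ball_le d) {p \<in> formal_balls. snd p < e}"
  unfolding scott_open_def
proof (intro conjI allI impI ballI)
  fix p q assume *: "p \<in> {p \<in> formal_balls. snd p < e}" "q \<in> formal_balls" "ball_le d p q"
  then have "snd q \<le> snd p"
    using nonneg[of "fst p" "fst q"] unfolding ball_le_def by linarith
  with * show "q \<in> {p \<in> formal_balls. snd p < e}"
    by simp
next
  fix D s assume "directed_in formal_balls (ball_le d) D \<and> is_lub_in formal_balls (ball_le d) D s \<and>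
    s \<in> {p \<in> formal_balls. snd p < e}"
  then have D: "directed_in formal_balls (ball_le d) D" "is_lub_in formal_balls (ball_le d) D s"
    and "e - snd s > 0" by auto
  obtain p where "p \<in> D" "snd p < snd s + (e - snd s)"
    using formal_balls_lub_approx[OF assms D \<open>e - snd s > 0\<close>] .
  moreover have "p \<in> formal_balls"
    using D(1) \<open>p \<in> D\<close> by (auto simp: directed_in_def)
  ultimately show "D \<inter> {p \<in> formal_balls. snd p < e} \<noteq> {}"
    by auto
qed auto

lemma gdelta_in_radius_zero:
  assumes "mcomplete"
  shows "gdelta_in (scott_topology formal_balls (ball_le d)) (M \<times> {0})"
proof -
  define B where "B n = {p \<in> formal_balls. snd p < inverse (real (Suc n))}" for n
  have "gdelta_in (scott_topology formal_balls (ball_le d)) (\<Inter>n. B n)"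
    unfolding B_def
    by (intro gdelta_in_Inter)
       (auto simp: openin_scott_topology intro!: open_imp_gdelta_in scott_open_radius_less[OF assms])
  moreover have "(\<Inter>n. B n) = M \<times> {0}"
  proof
    show "(\<Inter>n. B n) \<subseteq> M \<times> {0}"
    proof
      fix p assume p: "p \<in> (\<Inter>n. B n)"
      then have "fst p \<in> M" "0 \<le> snd p"
        by (auto simp: B_def)
      moreover have "\<not> 0 < snd p"
      proof
        assume "0 < snd p"
        then obtain n where "inverse (real (Suc n)) < snd p"
          using reals_Archimedean by blast
        moreover have "snd p < inverse (real (Suc n))"
          using p by (auto simp: B_def)
        ultimately show False by simp
      qed
      ultimately show "p \<in> M \<times> {0}"
        by (cases p) auto
    qed
  qed (auto simp: B_def)
  ultimately show ?thesis by simp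
qed

text \<open>A Scott-open set containing \<open>(x, 0)\<close> contains some \<open>(x, t)\<close>
  with \<open>t > 0\<close>, hence \<open>(z, 0)\<close> for all \<open>z\<close> in
  \<open>mball x t\<close>. Conversely, \<open>(x, r)\<close> is way below \<open>(y, 0)\<close>
  exactly when \<open>d x y < r\<close>, so open balls are traces of Scott-open sets.\<close>

lemma homeomorphic_maps_radius_zero:
  assumes "mcomplete"
  shows "homeomorphic_maps mtopology
    (subtopology (scott_topology formal_balls (ball_le d)) (M \<times> {0})) (\<lambda>x. (x, 0)) fst"
  unfolding homeomorphic_maps_def
proof (intro conjI)
  let ?Y = "scott_topology formal_balls (ball_le d)"
  have "openin mtopology {x \<in> M. (x, 0) \<in> U}" if "openin ?Y U" for U
    unfolding openin_mtopology
  proof (intro conjI allI impI)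
    fix x assume "x \<in> {x \<in> M. (x, 0) \<in> U}"
    then have x: "x \<in> M" "(x, 0) \<in> U" by auto
    have U: "scott_open formal_balls (ball_le d) U"
      using that by (simp add: openin_scott_topology)
    have "(\<lambda>t. (x, t)) ` {0<..} \<inter> U \<noteq> {}"
      using scott_open_meets[OF U larger_radii_lub[OF x(1) order_refl] x(2)] .
    then obtain t where t: "t > 0" "(x, t) \<in> U"
      by auto
    have "(z, 0) \<in> U" if "z \<in> mball x t" for z
      using that x(1) by (intro scott_open_upward[OF U t(2)]) (auto simp: ball_le_def)
    then have "mball x t \<subseteq> {x \<in> M. (x, 0) \<in> U}"
      by auto
    then show "\<exists>t>0. mball x t \<subseteq> {x \<in> M. (x, 0) \<in> U}"
      using t(1) by blast
  qed auto
  then show "continuous_map mtopology (subtopology ?Y (M \<times> {0})) (\<lambda>x. (x, 0))"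
    by (auto simp: continuous_map_in_subtopology continuous_map_def[of _ ?Y])
  have "openin (subtopology ?Y (M \<times> {0})) {p \<in> M \<times> {0}. fst p \<in> V}" if V: "openin mtopology V" for V
  proof -
    define \<U> where
      "\<U> = (\<Union>p\<in>{p\<in>formal_balls. mball (fst p) (snd p) \<subseteq> V}.
         {q\<in>formal_balls. way_below formal_balls (ball_le d) p q})"
    have "openin ?Y \<U>"
      unfolding \<U>_def
      using scott_open_way_above[OF continuous_dcpo_formal_balls[OF assms]]
      by (intro openin_Union) (auto simp: openin_scott_topology)
    moreover have "{p \<in> M \<times> {0}. fst p \<in> V} = \<U> \<inter> M \<times> {0}"
    proof (intro equalityI subsetI)
      fix q :: "'a \<times> real" assume "q \<in> {p \<in> M \<times> {0}. fst p \<in> V}"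
      then obtain y where y: "q = (y, 0)" "y \<in> M" "y \<in> V"
        by auto
      then obtain e where e: "e > 0" "mball y e \<subseteq> V"
        using V unfolding openin_mtopology by blast
      then have "way_below formal_balls (ball_le d) (y, e) q"
        using y by (simp add: way_below_formal_balls[OF assms])
      then show "q \<in> \<U> \<inter> M \<times> {0}"
        unfolding \<U>_def using y e by (intro IntI UN_I[of "(y, e)"]) auto
    next
      fix q assume q: "q \<in> \<U> \<inter> M \<times> {0}"
      then obtain p where p: "p \<in> formal_balls" "mball (fst p) (snd p) \<subseteq> V"
        "way_below formal_balls (ball_le d) p q" and "q \<in> formal_balls"
        by (auto simp: \<U>_def)
      then have "d (fst p) (fst q) < snd p - snd q"
        using way_below_formal_balls[OF assms p(1) \<open>q \<in> formal_balls\<close>] by simp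
      then have "fst q \<in> mball (fst p) (snd p)"
        using p(1) q by auto
      then show "q \<in> {p \<in> M \<times> {0}. fst p \<in> V}"
        using p(2) q by auto
    qed
    ultimately show ?thesis
      unfolding openin_subtopology by blast
  qed
  moreover have "topspace (subtopology ?Y (M \<times> {0})) = M \<times> {0}"
    by auto
  ultimately show "continuous_map (subtopology ?Y (M \<times> {0})) mtopology fst"
    unfolding continuous_map_def by auto
qed auto

lemma domain_complete_mtopology:
  assumes "mcomplete"
  shows "domain_complete_in TYPE('a \<times> real) mtopology"
  unfolding domain_complete_in_def homeomorphic_space_def
  using continuous_dcpo_formal_balls[OF assms] gdelta_in_radius_zero[OF assms]
    homeomorphic_maps_radius_zero[OF assms]
  by blast

end

subsection \<open>Metrizable LCS-complete spaces\<close>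

text \<open>A topological form of Rudin's lemma: a minimal closed set meeting all the compact sets
  \<open>E k\<close> below is irreducible, and the cluster point is its generic point.\<close>

lemma sober_space_cluster_point:
  fixes K :: "nat \<Rightarrow> 'b set"
  assumes sober: "sober_space Y"
    and K: "\<And>n. compactin Y (K n)" "\<And>n. saturated_in Y (K n)" "decseq K"
    and y: "\<And>k. \<forall>\<^sub>F n in sequentially. y n \<in> K k"
  obtains z where "z \<in> (\<Inter>k. K k)" "\<And>V. \<lbrakk>openin Y V; z \<in> V\<rbrakk> \<Longrightarrow> \<exists>\<^sub>F n in sequentially. y n \<in> V"
proof -
  define E where "E k = K k \<inter> Y closure_of (y ` {k..})" for k
  have Esub: "E n \<subseteq> E k" if "k \<le> n" for k n
    using that decseqD[OF K(3)] closure_of_mono[of "y ` {n..}" "y ` {k..}" Y]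
    by (fastforce simp: E_def)
  have Etop: "E k \<subseteq> topspace Y" for k
    using K(1) by (auto simp: E_def dest: compactin_subset_topspace)
  have Ecomp: "compactin Y (E k)" for k
    unfolding E_def by (simp add: K(1) compact_Int_closedin)
  have Ene: "E k \<noteq> {}" for k
  proof -
    obtain n where "n \<ge> k" "y n \<in> K k"
      using y[of k] unfolding eventually_sequentially by (meson linear order_refl)
    moreover have "y n \<in> topspace Y"
      using calculation K(1) compactin_subset_topspace by blast
    ultimately have "y n \<in> E k"
      unfolding E_def using closure_of_subset_Int[of Y "y ` {k..}"] by auto
    then show ?thesis by blast
  qed
  \<comment> \<open>The complements of the closed sets meeting every \<open>E k\<close>; a maximal
    member gives a minimal closed set.\<close>
  define \<U> where "\<U> = {U. openin Y U \<and> (\<forall>k. \<not> E k \<subseteq> U)}"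
  have "\<exists>U\<in>\<U>. \<forall>V\<in>\<U>. U \<subseteq> V \<longrightarrow> V = U"
  proof (rule subset_Zorn_nonempty)
    show "\<U> \<noteq> {}"
      using Ene by (auto simp: \<U>_def intro!: exI[of _ "{}"])
    fix \<C> assume \<C>: "\<C> \<noteq> {}" "subset.chain \<U> \<C>"
    then have "\<C> \<subseteq> \<U>"
      by (simp add: subset_chain_def)
    \<comment> \<open>By compactness finitely many members of the chain would cover
      \<open>E k\<close>, and the largest of them would do so alone.\<close>
    have "\<not> E k \<subseteq> \<Union>\<C>" for k
    proof
      assume "E k \<subseteq> \<Union>\<C>"
      moreover have "\<forall>U\<in>\<C>. openin Y U"
        using \<open>\<C> \<subseteq> \<U>\<close> by (auto simp: \<U>_def)
      ultimately obtain \<F> where \<F>: "finite \<F>" "\<F> \<subseteq> \<C>" "E k \<subseteq> \<Union>\<F>"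
        using Ecomp[of k] unfolding compactin_def by meson
      then have "\<F> \<noteq> {}"
        using Ene by auto
      moreover have "subset.chain \<U> \<F>"
        unfolding subset_chain_def
      proof (intro conjI ballI)
        show "\<F> \<subseteq> \<U>" using \<F>(2) \<open>\<C> \<subseteq> \<U>\<close> by (rule subset_trans)
        show "V \<subseteq> V' \<or> V' \<subseteq> V" if "V \<in> \<F>" "V' \<in> \<F>" for V V'
          using \<C>(2) that[THEN subsetD[OF \<F>(2)]] by (simp add: subset_chain_def)
      qed
      ultimately have "\<Union>\<F> \<in> \<F>"
        using \<F>(1) Union_in_chain by blast
      then show False
        using \<F> \<open>\<C> \<subseteq> \<U>\<close> by (auto simp: \<U>_def)
    qed
    then show "\<Union>\<C> \<in> \<U>"
      using \<open>\<C> \<subseteq> \<U>\<close> by (auto simp: \<U>_def)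
  qed
  then obtain U where U: "U \<in> \<U>" and Umax: "\<And>V. \<lbrakk>V \<in> \<U>; U \<subseteq> V\<rbrakk> \<Longrightarrow> V = U"
    by blast
  have "openin Y U" and nsub: "\<not> E k \<subseteq> U" for k
    using U by (auto simp: \<U>_def)
  define C where "C = topspace Y - U"
  have clC: "closedin Y C"
    using \<open>openin Y U\<close> by (auto simp: C_def)
  \<comment> \<open>Minimality of \<open>C\<close>: if \<open>C \<inter> A\<close> is properly
    smaller than \<open>C\<close>, it misses some \<open>E k\<close>.\<close>
  have split: "\<exists>k. E k \<subseteq> U \<union> (topspace Y - A)" if "closedin Y A" "\<not> C \<subseteq> A" for A
  proof (rule ccontr)
    assume "\<not> ?thesis"
    then have "U \<union> (topspace Y - A) \<in> \<U>"
      using that(1) \<open>openin Y U\<close> by (auto simp: \<U>_def)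
    then have "U \<union> (topspace Y - A) = U"
      by (rule Umax) auto
    then show False
      using that(2) by (auto simp: C_def)
  qed
  have "irreducible_closed_in Y C"
    unfolding irreducible_closed_in_def
  proof (intro conjI allI impI clC)
    show "C \<noteq> {}"
      using nsub Etop by (fastforce simp: C_def)
    fix A B assume AB: "closedin Y A \<and> closedin Y B \<and> C \<subseteq> A \<union> B"
    show "C \<subseteq> A \<or> C \<subseteq> B"
    proof (rule ccontr)
      assume "\<not> ?thesis"
      then obtain i j where "E i \<subseteq> U \<union> (topspace Y - A)" "E j \<subseteq> U \<union> (topspace Y - B)"
        using AB split by meson
      then have "E (max i j) \<subseteq> U \<union> (topspace Y - (A \<union> B))"
        using Esub[of i "max i j"] Esub[of j "max i j"] by auto
      then have "E (max i j) \<subseteq> U"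
        using AB by (auto simp: C_def)
      then show False
        using nsub by blast
    qed
  qed
  then obtain z where z: "z \<in> topspace Y" "C = Y closure_of {z}"
    using sober unfolding sober_space_def by blast
  then have "z \<in> C"
    by (simp add: in_closure_of)
  \<comment> \<open>\<open>C\<close> meets \<open>K k\<close> in a point \<open>w\<close> of the
    closure of \<open>z\<close>; each open set containing \<open>K k\<close> contains
    \<open>w\<close>, hence \<open>z\<close>, and saturation applies.\<close>
  have "z \<in> K k" for k
  proof -
    obtain w where w: "w \<in> K k" "w \<in> Y closure_of {z}"
      using nsub[of k] Etop[of k] z(2) by (auto simp: C_def E_def)
    have "z \<in> V" if "openin Y V" "K k \<subseteq> V" for V
      using that w by (auto simp: in_closure_of)
    then show ?thesis
      using K(2)[of k] z(1) unfolding saturated_in_def by blast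
  qed
  moreover have "z \<in> Y closure_of (y ` {k..})" for k
  proof (rule ccontr)
    assume "z \<notin> Y closure_of (y ` {k..})"
    then obtain j where "E j \<subseteq> U \<union> (topspace Y - Y closure_of (y ` {k..}))"
      using split[of "Y closure_of (y ` {k..})"] \<open>z \<in> C\<close> by auto
    then have "E (max j k) \<subseteq> U"
      using Esub[of j "max j k"] Esub[of k "max j k"] by (auto simp: E_def)
    then show False
      using nsub by blast
  qed
  then have "\<exists>\<^sub>F n in sequentially. y n \<in> V" if "openin Y V" "z \<in> V" for V
    unfolding frequently_sequentially using that by (fastforce simp: in_closure_of)
  ultimately show thesis
    by (intro that) auto
qed

text \<open>A choice function picking least elements. Choices from different sets thereby become
  comparable, and antisymmetry turns two comparisons into equality.\<close>

lemma well_order_least: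
  obtains r :: "'a rel" and l :: "'a set \<Rightarrow> 'a"
  where "antisym r" "\<And>Q. Q \<noteq> {} \<Longrightarrow> l Q \<in> Q" "\<And>Q q. q \<in> Q \<Longrightarrow> (l Q, q) \<in> r"
proof -
  obtain r :: "'a rel" where r: "Well_order r" "Field r = UNIV"
    using well_ordering by (elim exE conjE) (rule that)
  then have lin: "antisym r" "total r" "refl r" and wf: "wf (r - Id)"
    by (auto simp: well_order_on_def linear_order_on_def partial_order_on_def preorder_on_def)
  have "\<exists>m\<in>Q. \<forall>q\<in>Q. (m, q) \<in> r" if "Q \<noteq> {}" for Q
  proof -
    obtain x where "x \<in> Q"
      using \<open>Q \<noteq> {}\<close> by (meson ex_in_conv)
    with wf obtain m where m: "m \<in> Q" "\<And>q. (q, m) \<in> r - Id \<Longrightarrow> q \<notin> Q"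
      by (rule wfE_min) (rule that)
    have "(m, q) \<in> r" if "q \<in> Q" for q
      using m(2)[of q] that lin(2,3) by (cases "q = m") (auto simp: total_on_def refl_on_def)
    with m(1) show ?thesis by blast
  qed
  then have "\<forall>Q. \<exists>m. Q \<noteq> {} \<longrightarrow> m \<in> Q \<and> (\<forall>q\<in>Q. (m, q) \<in> r)"
    by blast
  from choice[OF this] obtain l where "\<forall>Q. Q \<noteq> {} \<longrightarrow> l Q \<in> Q \<and> (\<forall>q\<in>Q. (l Q, q) \<in> r)" ..
  then have l: "l Q \<in> Q" "q \<in> Q \<Longrightarrow> (l Q, q) \<in> r" if "Q \<noteq> {}" for Q q
    using that by simp_all
  have "(l Q, q) \<in> r" if "q \<in> Q" for Q q
    by (rule l(2)) (use that in auto)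
  with lin(1) l(1) show thesis
    by (rule that)
qed

section \<open>LCS-complete subspaces of a metric space are \<open>G_delta\<close> sets\<close>

lemma (in Metric_space) gdelta_in_LCS_complete_subspace:
  assumes "A \<subseteq> M" and LCS: "LCS_complete_in TYPE('b) (subtopology mtopology A)"
  shows "gdelta_in mtopology A"
proof -
  obtain Y :: "'b topology" and S where sober: "sober_space Y" and lc: "locally_compact_sat Y"
    and "gdelta_in Y S" and "subtopology mtopology A homeomorphic_space subtopology Y S"
    using LCS unfolding LCS_complete_in_def by blast
  then obtain f g U where fg: "homeomorphic_maps (subtopology mtopology A) (subtopology Y S) f g"
    and U: "\<And>n::nat. openin Y (U n)" "\<Inter>(range U) = S"
    unfolding homeomorphic_space_def gdelta_in_descending by blast
  have "S \<subseteq> topspace Y"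
    using \<open>gdelta_in Y S\<close> by (rule gdelta_in_subset)
  have contf: "continuous_map (subtopology mtopology A) (subtopology Y S) f"
    and contg: "continuous_map (subtopology Y S) (subtopology mtopology A) g"
    and gf: "\<And>x. x \<in> A \<Longrightarrow> g (f x) = x"
    using fg \<open>A \<subseteq> M\<close> \<open>S \<subseteq> topspace Y\<close> by (auto simp: homeomorphic_maps_def)
  have fS: "f x \<in> S" if "x \<in> A" for x
    using continuous_map_image_subset_topspace[OF contf] that \<open>A \<subseteq> M\<close> by auto
  have gA: "g z \<in> A" if "z \<in> S" for z
    using continuous_map_image_subset_topspace[OF contg] that \<open>S \<subseteq> topspace Y\<close> by auto
  have nbhd: "\<exists>e>0. \<forall>a \<in> mball x e \<inter> A. f a \<in> V" if "x \<in> A" "openin Y V" "f x \<in> V" for x V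
  proof -
    have "openin (subtopology mtopology A) {a \<in> topspace (subtopology mtopology A). f a \<in> V}"
      using continuous_map_into_fulltopology[OF contf] that(2) by (rule openin_continuous_map_preimage)
    then obtain T where T: "openin mtopology T" "{a \<in> topspace (subtopology mtopology A). f a \<in> V} = T \<inter> A"
      unfolding openin_subtopology by blast
    then have "x \<in> T"
      using that \<open>A \<subseteq> M\<close> by auto
    then obtain e where "e > 0" "mball x e \<subseteq> T"
      using T(1) unfolding openin_mtopology by blast
    then show ?thesis
      using T(2) by blast
  qed
  obtain r :: "'b set rel" and least where "antisym r"
    and least_in: "\<And>\<Q>. \<Q> \<noteq> {} \<Longrightarrow> least \<Q> \<in> \<Q>" and least_le: "\<And>\<Q> Q. Q \<in> \<Q> \<Longrightarrow> (least \<Q>, Q) \<in> r"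
    using well_order_least by metis
  \<comment> \<open>The possible successors of \<open>Q\<close> at \<open>x\<close>. Lying in the
    interior of \<open>Q\<close> makes the sequence decrease; lying in \<open>U n\<close> forces its
    intersection into \<open>S\<close>.\<close>
  define cand where "cand n Q x =
    {K. compactin Y K \<and> saturated_in Y K \<and> f x \<in> Y interior_of K \<and> K \<subseteq> Y interior_of Q \<inter> U n}"
    for n Q x
  \<comment> \<open>Stage \<open>0\<close> is the whole space, which need not be compact; candidates
    start at stage \<open>1\<close>, whence the shift by \<open>Suc\<close> throughout.\<close>
  define \<beta> where "\<beta> x = rec_nat (topspace Y) (\<lambda>n Q. least (cand n Q x))" for x
  have \<beta>0: "\<beta> x 0 = topspace Y" and \<beta>Suc: "\<beta> x (Suc n) = least (cand n (\<beta> x n) x)" for x n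
    by (simp_all add: \<beta>_def)
  have cand_ne: "cand n Q x \<noteq> {}" if "f x \<in> Y interior_of Q" "x \<in> A" for n Q x
  proof -
    have "openin Y (Y interior_of Q \<inter> U n)" "f x \<in> Y interior_of Q \<inter> U n" "f x \<in> topspace Y"
      using that U fS[OF that(2)] \<open>S \<subseteq> topspace Y\<close> by auto
    then show ?thesis
      using lc unfolding locally_compact_sat_def cand_def by blast
  qed
  have \<beta>int: "f x \<in> Y interior_of (\<beta> x n)" if "x \<in> A" for x n
  proof (induction n)
    case 0
    then show ?case
      using fS[OF that] \<open>S \<subseteq> topspace Y\<close> by (auto simp: \<beta>0)
  next
    case (Suc n)
    then show ?case
      using least_in[OF cand_ne[OF Suc that]] unfolding \<beta>Suc cand_def by blast
  qed
  have \<beta>cand: "\<beta> x (Suc n) \<in> cand n (\<beta> x n) x" if "x \<in> A" for x n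
    unfolding \<beta>Suc by (intro least_in cand_ne \<beta>int that)
  \<comment> \<open>Under these conditions the choice made at \<open>x\<close> is also a candidate
    at \<open>x'\<close>, so the least candidate at \<open>x'\<close> cannot exceed it.\<close>
  have \<beta>le: "(\<beta> x' (Suc n), \<beta> x (Suc n)) \<in> r"
    if "x \<in> A" "\<beta> x' n = \<beta> x n" "f x' \<in> Y interior_of (\<beta> x (Suc n))" for x x' n
  proof -
    have "\<beta> x (Suc n) \<in> cand n (\<beta> x' n) x'"
      using \<beta>cand[OF that(1), of n] that(2,3) by (auto simp: cand_def)
    then show ?thesis
      unfolding \<beta>Suc[of x'] by (rule least_le)
  qed
  \<comment> \<open>The bound on \<open>e\<close> makes the centres converge; the last clause
    transfers the first neighbourhoods of \<open>x\<close> to nearby points of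
    \<open>A\<close>.\<close>
  define good where "good n x e \<longleftrightarrow> 0 < e \<and> e \<le> inverse (real (Suc n)) \<and>
      (\<forall>k\<le>n. \<forall>a \<in> mball x e \<inter> A. f a \<in> Y interior_of (\<beta> x k))" for n x e
  have ex_good: "\<exists>e. good n x e" if "x \<in> A" for x n
  proof -
    have "openin Y (\<Inter>k\<in>{..n}. Y interior_of (\<beta> x k))"
      by (intro openin_Inter) auto
    moreover have "f x \<in> (\<Inter>k\<in>{..n}. Y interior_of (\<beta> x k))"
      using \<beta>int[OF that] by blast
    ultimately obtain e where e: "e > 0"
        "\<forall>a \<in> mball x e \<inter> A. f a \<in> (\<Inter>k\<in>{..n}. Y interior_of (\<beta> x k))"
      using nbhd[OF \<open>x \<in> A\<close>] by metis
    have "mball x (min e (inverse (real (Suc n)))) \<subseteq> mball x e"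
      by (rule mball_subset_concentric) simp
    with e show ?thesis
      unfolding good_def by (intro exI[of _ "min e (inverse (real (Suc n)))"]) auto
  qed
  define \<epsilon> where "\<epsilon> n x = (SOME e. good n x e)" for n x
  have "good n x (\<epsilon> n x)" if "x \<in> A" for n x
    unfolding \<epsilon>_def using ex_good[OF that] by (rule someI_ex)
  then have \<epsilon>: "\<And>n x. x \<in> A \<Longrightarrow> 0 < \<epsilon> n x" "\<And>n x. x \<in> A \<Longrightarrow> \<epsilon> n x \<le> inverse (real (Suc n))"
    "\<And>n x k a. \<lbrakk>x \<in> A; k \<le> n; a \<in> mball x (\<epsilon> n x); a \<in> A\<rbrakk> \<Longrightarrow> f a \<in> Y interior_of (\<beta> x k)"
    by (auto simp: good_def)
  define W where "W n = (\<Union>x\<in>A. mball x (\<epsilon> n x))" for n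
  have "p \<in> A" if p: "p \<in> (\<Inter>n. W n)" for p
  proof -
    have "\<exists>x\<in>A. p \<in> mball x (\<epsilon> n x)" for n
      using p by (auto simp: W_def)
    then obtain x where x: "\<And>n. x n \<in> A" "\<And>n. p \<in> mball (x n) (\<epsilon> n (x n))"
      by metis
    then have "p \<in> M" and xM: "\<And>n. x n \<in> M"
      using \<open>A \<subseteq> M\<close> by auto
    have conv: "\<forall>\<^sub>F n in sequentially. d (x n) p < e" if "e > 0" for e
    proof -
      have "\<forall>\<^sub>F n in sequentially. inverse (real (Suc n)) < e"
        using Archimedean_eventually_inverse that by blast
      then show ?thesis
      proof eventually_elim
        case (elim n)
        then show ?case
          using x[of n] \<epsilon>(2)[of "x n" n] by auto
      qed
    qed
    \<comment> \<open>\<open>p\<close> lies in the open ball around \<open>x m\<close>, so the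
      centres converging to \<open>p\<close> eventually enter that ball.\<close>
    have near: "\<forall>\<^sub>F n in sequentially. f (x n) \<in> Y interior_of (\<beta> (x m) k)" if "k \<le> m" for k m
    proof -
      have "0 < \<epsilon> m (x m) - d (x m) p"
        using x(2)[of m] by simp
      then show ?thesis
      proof (rule eventually_mono[OF conv])
        fix n assume "d (x n) p < \<epsilon> m (x m) - d (x m) p"
        then have "x n \<in> mball (x m) (\<epsilon> m (x m))"
          using triangle[of "x m" p "x n"] commute[of "x n" p] xM \<open>p \<in> M\<close> by auto
        then show "f (x n) \<in> Y interior_of (\<beta> (x m) k)"
          using \<epsilon>(3) x(1) that by blast
      qed
    qed
    have "\<exists>c. \<forall>\<^sub>F n in sequentially. \<beta> (x n) k = c" for k
    proof (induction k)
      case 0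
      then show ?case by (auto simp: \<beta>0)
    next
      case (Suc k)
      then obtain c N where c: "\<And>n. n \<ge> N \<Longrightarrow> \<beta> (x n) k = c"
        by (auto simp: eventually_sequentially)
      \<comment> \<open>Beyond \<open>N\<close> stage \<open>k\<close> is constant, and beyond
        \<open>Suc k\<close> the fact \<open>near\<close> applies at stage \<open>Suc k\<close>. The
        least value is attained at some \<open>m\<close>; later values are at least this one by
        choice of \<open>m\<close>, and eventually at most this one by
        \<open>\<beta>le\<close>.\<close>
      define B where "B = (\<lambda>m. \<beta> (x m) (Suc k)) ` {max N (Suc k)..}"
      then have "least B \<in> B"
        by (intro least_in) auto
      then obtain m where m: "m \<ge> N" "m \<ge> Suc k" "least B = \<beta> (x m) (Suc k)"
        by (auto simp: B_def)
      have "\<forall>\<^sub>F n in sequentially. \<beta> (x n) (Suc k) = \<beta> (x m) (Suc k)"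
        using near[OF m(2)] eventually_ge_at_top[of "max N (Suc k)"]
      proof eventually_elim
        case (elim n)
        then have "(\<beta> (x n) (Suc k), \<beta> (x m) (Suc k)) \<in> r"
          using c m(1) by (intro \<beta>le x) auto
        moreover have "(\<beta> (x m) (Suc k), \<beta> (x n) (Suc k)) \<in> r"
          unfolding m(3)[symmetric] using elim(2) by (intro least_le) (simp add: B_def)
        ultimately show ?case
          using \<open>antisym r\<close> by (auto dest: antisymD)
      qed
      then show ?case by blast
    qed
    then obtain c where c: "\<And>k. \<forall>\<^sub>F n in sequentially. \<beta> (x n) k = c k"
      by metis
    have c_cand: "\<forall>\<^sub>F n in sequentially. c (Suc k) \<in> cand k (c k) (x n)" for k
      using c[of k] c[of "Suc k"]
    proof eventually_elim
      case (elim n)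
      then show ?case
        using \<beta>cand[OF x(1), of n k] by simp
    qed
    have "\<exists>n. c (Suc k) \<in> cand k (c k) (x n)" for k
      using eventually_happens[OF c_cand[of k]] by simp
    then have cK: "compactin Y (c (Suc k))" "saturated_in Y (c (Suc k))" "c (Suc k) \<subseteq> U k"
      "c (Suc k) \<subseteq> c k" for k
      using interior_of_subset[of Y "c k"] unfolding cand_def by blast+
    moreover have "decseq (\<lambda>k. c (Suc k))"
      using cK(4) by (intro decseq_SucI) auto
    moreover have "\<forall>\<^sub>F n in sequentially. f (x n) \<in> c (Suc k)" for k
      using c_cand[of k]
    proof eventually_elim
      case (elim n)
      then show ?case
        using interior_of_subset[of Y "c (Suc k)"] by (auto simp: cand_def)
    qed
    ultimately obtain z where z: "z \<in> (\<Inter>k. c (Suc k))"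
      and cluster: "\<And>V. \<lbrakk>openin Y V; z \<in> V\<rbrakk> \<Longrightarrow> \<exists>\<^sub>F n in sequentially. f (x n) \<in> V"
      using sober_space_cluster_point[OF sober, of "\<lambda>k. c (Suc k)" "\<lambda>n. f (x n)"] by blast
    have "z \<in> S"
      using z cK(3) U(2) by blast
    have "g z \<in> M"
      using gA[OF \<open>z \<in> S\<close>] \<open>A \<subseteq> M\<close> by blast
    \<comment> \<open>Otherwise \<open>x n\<close> would be within half the distance of
      \<open>g z\<close> for infinitely many \<open>n\<close>, by clustering at \<open>z\<close> and
      continuity of \<open>g\<close>, and eventually within half the distance of
      \<open>p\<close>.\<close>
    have "g z = p"
    proof (rule ccontr)
      assume "g z \<noteq> p"
      define \<delta> where "\<delta> = d (g z) p / 2"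
      have "\<delta> > 0"
        using \<open>g z \<noteq> p\<close> \<open>g z \<in> M\<close> \<open>p \<in> M\<close> by (simp add: \<delta>_def)
      have "openin (subtopology Y S) {w \<in> topspace (subtopology Y S). g w \<in> mball (g z) \<delta>}"
        using continuous_map_into_fulltopology[OF contg] openin_mball by (rule openin_continuous_map_preimage)
      then obtain V where V: "openin Y V" "{w \<in> topspace (subtopology Y S). g w \<in> mball (g z) \<delta>} = V \<inter> S"
        unfolding openin_subtopology by blast
      then have "z \<in> V"
        using \<open>z \<in> S\<close> \<open>S \<subseteq> topspace Y\<close> \<open>g z \<in> M\<close> \<open>\<delta> > 0\<close> by auto
      then have "\<exists>\<^sub>F n in sequentially. f (x n) \<in> V \<and> d (x n) p < \<delta>"
        using frequently_eventually_conj[OF cluster[OF V(1)] conv[OF \<open>\<delta> > 0\<close>]] by (simp add: conj_commute)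
      then obtain n where n: "f (x n) \<in> V" "d (x n) p < \<delta>"
        by (auto dest: frequently_ex)
      then have "g (f (x n)) \<in> mball (g z) \<delta>"
        using V(2) fS[OF x(1)] by blast
      then have "d (g z) (x n) < \<delta>"
        using gf[OF x(1)] by simp
      then show False
        using n(2) triangle[of "g z" "x n" p] \<open>g z \<in> M\<close> \<open>p \<in> M\<close> xM by (simp add: \<delta>_def)
    qed
    then show "p \<in> A"
      using gA \<open>z \<in> S\<close> by blast
  qed
  moreover have "A \<subseteq> (\<Inter>n. W n)"
    using \<epsilon>(1) \<open>A \<subseteq> M\<close> by (force simp: W_def)
  ultimately have "A = (\<Inter>n. W n)"
    by blast
  moreover have "gdelta_in mtopology (\<Inter>n. W n)"
    by (intro gdelta_in_Inter) (auto simp: W_def intro!: open_imp_gdelta_in)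
  ultimately show ?thesis
    by simp
qed

text \<open>Embed \<open>X\<close> isometrically into its completion. LCS-completeness passes to the
  image, which is thus a \<open>G_delta\<close> set in a completely metrizable space and so
  completely metrizable itself.\<close>

lemma LCS_complete_imp_completely_metrizable:
  assumes "metrizable_space X" and LCS: "LCS_complete_in TYPE('b) X"
  shows "completely_metrizable_space X"
proof -
  obtain M d where "Metric_space M d" and X: "X = Metric_space.mtopology M d"
    using assms(1) unfolding metrizable_space_def by blast
  interpret Metric_space M d by fact
  obtain f :: "['a,'a] \<Rightarrow> real" and m' where
    "mcomplete_of m'" and fim: "f \<in> M \<rightarrow> mspace m'"
    and "\<And>x y. \<lbrakk>x \<in> M; y \<in> M\<rbrakk> \<Longrightarrow> mdist m' (f x) (f y) = d x y"
    by (metis metric_completion)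
  then have "embedding_map X (mtopology_of m') f"
    unfolding mtopology_of_def X
    by (metis Metric_space12.isometry_imp_embedding_map Metric_space12_mspace_mdist mdist_metric mspace_metric)
  then have hom: "X homeomorphic_space subtopology (mtopology_of m') (f ` M)"
    unfolding X by (metis embedding_map_imp_homeomorphic_space topspace_mtopology)
  then have "LCS_complete_in TYPE('b) (subtopology (mtopology_of m') (f ` M))"
    using LCS homeomorphic_space_trans homeomorphic_space_sym unfolding LCS_complete_in_def by blast
  moreover have "f ` M \<subseteq> mspace m'"
    using fim by blast
  ultimately have "gdelta_in (mtopology_of m') (f ` M)"
    using Metric_space.gdelta_in_LCS_complete_subspace[OF Metric_space_mspace_mdist]
    unfolding mtopology_of_def by blast
  moreover have "completely_metrizable_space (mtopology_of m')"
    using \<open>mcomplete_of m'\<close> unfolding mcomplete_of_def mtopology_of_def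
    by (simp add: Metric_space.completely_metrizable_space_mtopology)
  ultimately show ?thesis
    using completely_metrizable_space_gdelta_in hom homeomorphic_completely_metrizable_space by blast
qed

text \<open>The implications towards complete metrizability hold for every carrier type
  \<open>'b\<close> of the witness; the converse names the carrier \<open>'a \<times> real\<close>
  of the formal balls.\<close>

theorem theorem9p2:
  fixes X :: "'a topology"
  assumes "metrizable_space X"
  shows "(LCS_complete_in TYPE('b) X \<longrightarrow> completely_metrizable_space X)
       \<and> (domain_complete_in TYPE('b) X \<longrightarrow> completely_metrizable_space X)
       \<and> (completely_metrizable_space X \<longrightarrow>
              LCS_complete_in TYPE('a \<times> real) X \<and> domain_complete_in TYPE('a \<times> real) X)"
proof (intro conjI impI)
  show "completely_metrizable_space X" if "LCS_complete_in TYPE('b) X"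
    using assms that by (rule LCS_complete_imp_completely_metrizable)
  show "completely_metrizable_space X" if "domain_complete_in TYPE('b) X"
    using assms domain_complete_imp_LCS_complete[OF that]
    by (rule LCS_complete_imp_completely_metrizable)
  assume "completely_metrizable_space X"
  then obtain M d where "Metric_space M d" "Metric_space.mcomplete M d"
    and X: "X = Metric_space.mtopology M d"
    unfolding completely_metrizable_space_def by blast
  then show dc: "domain_complete_in TYPE('a \<times> real) X"
    by (simp add: Metric_space.domain_complete_mtopology)
  then show "LCS_complete_in TYPE('a \<times> real) X"
    by (rule domain_complete_imp_LCS_complete)
qed

end
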